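(* Let $(\underline P,\overline P)$ be a Vertical Barrier Model on $\mathcal A(\mathbb P)$, let $A\in\mathcal A(\mathbb P)$ and let $\mathcal B\subset\mathcal A(\mathbb P)\setminus\{\emptyset\}$ be a partition. Suppose that $\underline P(B)>0$ for all $B\in\mathcal B$. If there is $B^*\in\mathcal B$ such that $\underline P(A\wedge B^* )>0$ and $\underline P(A^{\mathsf c}\wedge B^* )>0$, then $\mathcal B$ does not constrict $A$.
   Context: Let $\mathbb P$ be a partition (finite or infinite) of the sure event $\Omega$ and $\mathcal A(\mathbb P)$ the set of events logically dependent on $\mathbb P$, i.e. (identifying events with sets) the power set of $\mathbb P$, with $\Omega$ the whole set, $\emptyset$ the impossible event, $\wedge,{}^{\mathsf c}$ intersection and complement. A partition $\mathcal B\subset\mathcal A(\mathbb P)\setminus\{\emptyset\}$ is a family of pairwise disjoint non-empty events whose union is $\Omega$. "Probability" means finitely additive probability on $\mathcal A(\mathbb P)$. Vertical Barrier Model (VBM): given a probability $P_0$ on $\mathcal A(\mathbb P)$ and $b>0$, $a\le 0$ with $0\le a+b\le 1$, and $c=1-(a+b)$, put $\underline P(A)=\max\{bP_0(A)+a,0\}$ for $A\ne\Omega$, $\underline P(\Omega)=1$; $\overline P(A)=\min\{bP_0(A)+c,1\}$ for $A\ne\emptyset$, $\overline P(\emptyset)=0$. Natural extension: let $\mathcal M=\{P \text{ probability on }\mathcal A(\mathbb P): P\ge\underline P\}$. For $B\ne\emptyset$, let $\mathcal M_B$ be the set of pairs $(P,P(\cdot|B))$ with $P\in\mathcal M$ and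 $P(\cdot|B)$ a probability on $\mathcal A(\mathbb P)$ satisfying $P(B|B)=1$ and $P(A\wedge B)=P(A|B)P(B)$ for all $A\in\mathcal A(\mathbb P)$. Then $\underline E(A|B)=\inf_{\mathcal M_B}P(A|B)$ and $\overline E(A|B)=\sup_{\mathcal M_B}P(A|B)$. $\mathcal B$ constricts $A$ if $\underline P(A)\le\underline E(A|B)\le\overline E(A|B)\le\overline P(A)$ for all $B\in\mathcal B$, with at least one of the outer inequalities being strict for at least one $B\in\mathcal B$. *)

theory Defs
  imports Complex_Main "HOL-Library.Disjoint_Sets"
begin

text \<open>
  The type \<open>'a\<close> is the (finite or infinite, arbitrary) set of atoms of the underlying partition
  of the sure event.  Events are thus all sets of type \<open>'a set\<close>, with \<open>UNIV\<close> the sure event.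
\<close>

definition fa_probability :: "('a set \<Rightarrow> real) \<Rightarrow> bool" where
  "fa_probability P \<longleftrightarrow>
     (\<forall>A. 0 \<le> P A) \<and> P UNIV = 1 \<and> (\<forall>A B. A \<inter> B = {} \<longrightarrow> P (A \<union> B) = P A + P B)"

definition vbm_lower :: "('a set \<Rightarrow> real) \<Rightarrow> real \<Rightarrow> real \<Rightarrow> 'a set \<Rightarrow> real" where
  "vbm_lower P\<^sub>0 a b A = (if A = UNIV then 1 else max (b * P\<^sub>0 A + a) 0)"

definition vbm_upper :: "('a set \<Rightarrow> real) \<Rightarrow> real \<Rightarrow> real \<Rightarrow> 'a set \<Rightarrow> real" where
  "vbm_upper P\<^sub>0 a b A =
     (let c = 1 - (a + b) in if A = {} then 0 else min (b * P\<^sub>0 A + c) 1)"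

definition vertical_barrier_model :: "('a set \<Rightarrow> real) \<Rightarrow> ('a set \<Rightarrow> real) \<Rightarrow> bool" where
  "vertical_barrier_model Pl Pu \<longleftrightarrow>
     (\<exists>P\<^sub>0 a b. fa_probability P\<^sub>0 \<and> b > 0 \<and> a \<le> 0 \<and> 0 \<le> a + b \<and> a + b \<le> 1 \<and>
        Pl = vbm_lower P\<^sub>0 a b \<and> Pu = vbm_upper P\<^sub>0 a b)"

definition credal_set :: "('a set \<Rightarrow> real) \<Rightarrow> ('a set \<Rightarrow> real) set" where
  "credal_set Pl = {P. fa_probability P \<and> (\<forall>A. Pl A \<le> P A)}"

text \<open>
  The second component \<open>Q\<close> of a pair is a conditional probability given \<open>B\<close>; it is only
  constrained by the product rule and normalisation, so \<open>P B = 0\<close> is allowed.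
\<close>

definition cond_credal_set ::
  "('a set \<Rightarrow> real) \<Rightarrow> 'a set \<Rightarrow> (('a set \<Rightarrow> real) \<times> ('a set \<Rightarrow> real)) set" where
  "cond_credal_set Pl B =
     {(P, Q). P \<in> credal_set Pl \<and> fa_probability Q \<and> Q B = 1 \<and>
        (\<forall>A. P (A \<inter> B) = Q A * P B)}"

text \<open>
  The infimum and supremum are taken in the reals, so the values are meaningful only if
  \<open>cond_credal_set Pl B\<close> is nonempty (all values \<open>Q A\<close> lie between 0 and 1).  This holds
  for the lower probability of a Vertical Barrier Model and \<open>B \<noteq> {}\<close>, because
  \<open>P\<^sub>0\<close> itself dominates \<open>vbm_lower P\<^sub>0 a b\<close> and has a conditional probability given
  \<open>B\<close> (a point mass in \<open>B\<close> if \<open>P\<^sub>0 B = 0\<close>).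
\<close>

definition nat_ext_lower :: "('a set \<Rightarrow> real) \<Rightarrow> 'a set \<Rightarrow> 'a set \<Rightarrow> real" where
  "nat_ext_lower Pl A B = (INF (P, Q) \<in> cond_credal_set Pl B. Q A)"

definition nat_ext_upper :: "('a set \<Rightarrow> real) \<Rightarrow> 'a set \<Rightarrow> 'a set \<Rightarrow> real" where
  "nat_ext_upper Pl A B = (SUP (P, Q) \<in> cond_credal_set Pl B. Q A)"

definition constricts ::
  "('a set \<Rightarrow> real) \<Rightarrow> ('a set \<Rightarrow> real) \<Rightarrow> 'a set set \<Rightarrow> 'a set \<Rightarrow> bool" where
  "constricts Pl Pu \<B> A \<longleftrightarrow>
     (\<forall>B\<in>\<B>. Pl A \<le> nat_ext_lower Pl A B \<and>
            nat_ext_lower Pl A B \<le> nat_ext_upper Pl A B \<and>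
            nat_ext_upper Pl A B \<le> Pu A) \<and>
     (\<exists>B\<in>\<B>. Pl A < nat_ext_lower Pl A B \<or> nat_ext_upper Pl A B < Pu A)"

end

theory Submission
  imports Defs
begin

text \<open>
  Put \<open>x = P\<^sub>0 (A \<inter> B\<^sup>*)\<close>, \<open>y = P\<^sub>0 (- A \<inter> B\<^sup>*)\<close>, \<open>c = 1 - (a + b)\<close>.  Adding to \<open>b P\<^sub>0\<close> the
  masses \<open>a\<close> and \<open>c\<close>, spread like \<open>P\<^sub>0\<close> over \<open>A \<inter> B\<^sup>*\<close> and \<open>- A \<inter> B\<^sup>*\<close> respectively, gives a
  probability dominating \<open>Pl\<close>; exchanging the two masses gives another one.  Both have the
  same value \<open>D = b (x + y) + 1 - b \<le> 1\<close> on \<open>B\<^sup>*\<close>, so the lower and upper natural extensions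
  of \<open>A\<close> given \<open>B\<^sup>*\<close> are at distance at least \<open>(c - a) / D\<close>, whereas \<open>Pu A - Pl A \<le> c - a\<close>.
  If \<open>\<B>\<close> constricts \<open>A\<close>, then \<open>c = a\<close> or \<open>D = 1\<close>.  In the first case \<open>a = c = 0\<close> and \<open>Pl = Pu = P\<^sub>0\<close>.
  In the second case \<open>P\<^sub>0 B\<^sup>* = 1\<close>, so \<open>B\<^sup>*\<close> is the only element of \<open>\<B>\<close> and the two
  probabilities above attain \<open>Pl A\<close> and \<open>Pu A\<close>.  Neither case leaves room for strictness.
\<close>

lemma fa_probability_nonneg: "fa_probability P \<Longrightarrow> 0 \<le> P E"
  and fa_probability_UNIV: "fa_probability P \<Longrightarrow> P UNIV = 1"
  and fa_probability_Un: "fa_probability P \<Longrightarrow> E \<inter> F = {} \<Longrightarrow> P (E \<union> F) = P E + P F"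
  by (auto simp: fa_probability_def)

lemma fa_probability_empty: "fa_probability P \<Longrightarrow> P {} = 0"
  using fa_probability_Un[of P "{}" "{}"] by simp

lemma fa_probability_split:
  assumes "fa_probability P"
  shows "P E = P (C \<inter> E) + P (- C \<inter> E)"
proof -
  have "P ((C \<inter> E) \<union> (- C \<inter> E)) = P (C \<inter> E) + P (- C \<inter> E)"
    by (rule fa_probability_Un[OF assms]) auto
  moreover have "(C \<inter> E) \<union> (- C \<inter> E) = E" by auto
  ultimately show ?thesis by simp
qed

lemma fa_probability_mono:
  assumes "fa_probability P" "E \<subseteq> F"
  shows "P E \<le> P F"
proof -
  have "E \<inter> F = E" using assms(2) by auto
  then show ?thesis
    using fa_probability_split[OF assms(1), of F E] fa_probability_nonneg[OF assms(1)] by simp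
qed

lemma fa_probability_le_1: "fa_probability P \<Longrightarrow> P E \<le> 1"
  using fa_probability_mono[of P E UNIV] fa_probability_UNIV[of P] by simp

lemma fa_probability_cond:
  assumes "fa_probability P" "P B > 0"
  shows "fa_probability (\<lambda>E. P (E \<inter> B) / P B)"
  unfolding fa_probability_def
proof (intro conjI allI impI)
  fix E F :: "'a set" assume "E \<inter> F = {}"
  then have "(E \<inter> B) \<inter> (F \<inter> B) = {}" by auto
  then show "P ((E \<union> F) \<inter> B) / P B = P (E \<inter> B) / P B + P (F \<inter> B) / P B"
    using fa_probability_Un[OF assms(1), of "E \<inter> B" "F \<inter> B"]
    by (simp add: Int_Un_distrib2 add_divide_distrib)
qed (use assms in \<open>auto intro: fa_probability_nonneg divide_nonneg_pos\<close>)

text \<open>As \<open>P B > 0\<close>, \<open>P\<close> paired with its Bayes conditional lies in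
  \<open>cond_credal_set Pl B\<close>. Conditional values stay in [0,1], so the real
  \<open>INF\<close> and \<open>SUP\<close> are genuine bounds.\<close>

lemma nat_ext_bounds:
  assumes "P \<in> credal_set Pl" "P B > 0"
  shows "nat_ext_lower Pl A B \<le> P (A \<inter> B) / P B"
    and "P (A \<inter> B) / P B \<le> nat_ext_upper Pl A B"
proof -
  define Q where "Q = (\<lambda>E. P (E \<inter> B) / P B)"
  have PQ: "(P, Q) \<in> cond_credal_set Pl B"
    using assms fa_probability_cond[of P B] by (auto simp: cond_credal_set_def credal_set_def Q_def)
  have below: "bdd_below ((\<lambda>(P, Q). Q A) ` cond_credal_set Pl B)"
    by (rule bdd_belowI[of _ 0]) (auto simp: cond_credal_set_def intro: fa_probability_nonneg)
  have above: "bdd_above ((\<lambda>(P, Q). Q A) ` cond_credal_set Pl B)"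
    by (rule bdd_aboveI[of _ 1]) (auto simp: cond_credal_set_def intro: fa_probability_le_1)
  show "nat_ext_lower Pl A B \<le> P (A \<inter> B) / P B"
    using cINF_lower[OF below PQ] by (simp add: nat_ext_lower_def Q_def)
  show "P (A \<inter> B) / P B \<le> nat_ext_upper Pl A B"
    using cSUP_upper[OF PQ above] by (simp add: nat_ext_upper_def Q_def)
qed

text \<open>Only the mass \<open>a\<close> is negative. Inside \<open>C\<close> it rescales
  \<open>b * P\<^sub>0\<close> by a nonnegative factor, and no event loses more than
  \<open>- a\<close>, whence domination. The mass \<open>c\<close> brings the total to 1.\<close>

lemma vbm_mass_transfer_in_credal_set:
  fixes P\<^sub>0 :: "'a set \<Rightarrow> real" and a b :: real
  defines "c \<equiv> 1 - (a + b)"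
  defines "P C D E \<equiv> b * P\<^sub>0 E + a * (P\<^sub>0 (E \<inter> C) / P\<^sub>0 C) + c * (P\<^sub>0 (E \<inter> D) / P\<^sub>0 D)"
  assumes P0: "fa_probability P\<^sub>0" and "b > 0" "a \<le> 0" "a + b \<le> 1"
    and C: "b * P\<^sub>0 C + a \<ge> 0" "P\<^sub>0 C > 0" and D: "P\<^sub>0 D > 0"
  shows "P C D \<in> credal_set (vbm_lower P\<^sub>0 a b)"
proof -
  note condC = fa_probability_cond[OF P0 C(2)] and condD = fa_probability_cond[OF P0 D]
  have c: "c \<ge> 0" using assms by simp
  have D_nonneg: "0 \<le> c * (P\<^sub>0 (E \<inter> D) / P\<^sub>0 D)" for E
    by (rule mult_nonneg_nonneg[OF c fa_probability_nonneg[OF condD]])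
  have nonneg: "0 \<le> P C D E" for E
  proof -
    have "0 \<le> (b * P\<^sub>0 C + a) * (P\<^sub>0 (E \<inter> C) / P\<^sub>0 C)"
      using C fa_probability_nonneg[OF P0] by simp
    also have "\<dots> = b * P\<^sub>0 (E \<inter> C) + a * (P\<^sub>0 (E \<inter> C) / P\<^sub>0 C)"
      using C(2) by (simp add: field_simps)
    also have "\<dots> \<le> b * P\<^sub>0 E + a * (P\<^sub>0 (E \<inter> C) / P\<^sub>0 C)"
      using fa_probability_mono[OF P0, of "E \<inter> C" E] \<open>b > 0\<close> by simp
    finally show ?thesis using D_nonneg[of E] unfolding P_def by linarith
  qed
  have dominates: "b * P\<^sub>0 E + a \<le> P C D E" for E
    using D_nonneg[of E] mult_left_mono_neg[OF fa_probability_le_1[OF condC, of E] \<open>a \<le> 0\<close>]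
    unfolding P_def by simp
  have total: "P C D UNIV = 1"
    using C(2) D fa_probability_UNIV[OF P0] by (simp add: P_def c_def)
  have "P C D (E \<union> F) = P C D E + P C D F" if "E \<inter> F = {}" for E F
    unfolding P_def fa_probability_Un[OF P0 that] fa_probability_Un[OF condC that]
      fa_probability_Un[OF condD that]
    by (simp add: algebra_simps)
  then have "fa_probability (P C D)"
    using nonneg total by (simp add: fa_probability_def)
  then show ?thesis
    using nonneg dominates total by (simp add: credal_set_def vbm_lower_def)
qed

theorem proposition5p5:
  fixes Pl Pu :: "'a set \<Rightarrow> real" and A :: "'a set" and \<B> :: "'a set set"
  assumes "vertical_barrier_model Pl Pu"
    and "partition_on UNIV \<B>"
    and "\<forall>B\<in>\<B>. Pl B > 0"
    and "\<exists>B'\<in>\<B>. Pl (A \<inter> B') > 0 \<and> Pl (- A \<inter> B') > 0"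
  shows "\<not> constricts Pl Pu \<B> A"
proof
  assume con: "constricts Pl Pu \<B> A"
  from assms(1) obtain P\<^sub>0 a b where P0: "fa_probability P\<^sub>0"
    and ab: "b > 0" "a \<le> 0" "0 \<le> a + b" "a + b \<le> 1"
    and Pl: "Pl = vbm_lower P\<^sub>0 a b" and Pu: "Pu = vbm_upper P\<^sub>0 a b"
    unfolding vertical_barrier_model_def by blast
  define c where "c = 1 - (a + b)"
  from assms(4) obtain B where B: "B \<in> \<B>" "Pl (A \<inter> B) > 0" "Pl (- A \<inter> B) > 0" by blast
  have c0: "c \<ge> 0" using ab by (simp add: c_def)
  have Pl_empty: "Pl {} = 0"
    using ab fa_probability_empty[OF P0] by (simp add: Pl vbm_lower_def)
  then have ne: "A \<inter> B \<noteq> {}" "- A \<inter> B \<noteq> {}" using B by auto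
  \<comment> \<open>This keeps the exceptional values at \<open>UNIV\<close> and \<open>{}\<close>
    out of the formulas for \<open>Pl\<close> and \<open>Pu\<close>.\<close>
  have nU: "A \<inter> B \<noteq> UNIV" "- A \<inter> B \<noteq> UNIV" "A \<noteq> UNIV" "A \<noteq> {}" using ne by auto
  have P0_pos: "P\<^sub>0 E > 0" if "b * P\<^sub>0 E + a > 0" for E
    using that ab fa_probability_nonneg[OF P0, of E] by (cases "P\<^sub>0 E = 0") auto
  have pos: "b * P\<^sub>0 (A \<inter> B) + a > 0" "b * P\<^sub>0 (- A \<inter> B) + a > 0"
    using B(2,3) nU(1,2) by (simp_all add: Pl vbm_lower_def less_max_iff_disj split: if_splits)
  note xy = pos[THEN P0_pos]
  define P where "P C D E =
    b * P\<^sub>0 E + a * (P\<^sub>0 (E \<inter> C) / P\<^sub>0 C) + c * (P\<^sub>0 (E \<inter> D) / P\<^sub>0 D)" for C D E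
  note transfer = vbm_mass_transfer_in_credal_set[OF P0 ab(1,2,4), folded c_def Pl]
  have Plow: "P (A \<inter> B) (- A \<inter> B) \<in> credal_set Pl"
    using transfer[of "A \<inter> B" "- A \<inter> B"] pos xy unfolding P_def by simp
  have Pup: "P (- A \<inter> B) (A \<inter> B) \<in> credal_set Pl"
    using transfer[of "- A \<inter> B" "A \<inter> B"] pos xy unfolding P_def by simp
  have ints: "A \<inter> B \<inter> (A \<inter> B) = A \<inter> B" "A \<inter> B \<inter> (- A \<inter> B) = {}" "B \<inter> (A \<inter> B) = A \<inter> B"
    "B \<inter> (- A \<inter> B) = - A \<inter> B" by auto
  define D where "D = b * P\<^sub>0 B + a + c"
  have vals: "P (A \<inter> B) (- A \<inter> B) (A \<inter> B) = b * P\<^sub>0 (A \<inter> B) + a"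
    "P (- A \<inter> B) (A \<inter> B) (A \<inter> B) = b * P\<^sub>0 (A \<inter> B) + c"
    "P (A \<inter> B) (- A \<inter> B) B = D" "P (- A \<inter> B) (A \<inter> B) B = D"
    using xy fa_probability_empty[OF P0] by (simp_all add: P_def ints D_def)
  have "P\<^sub>0 (A \<inter> B) \<le> P\<^sub>0 B" by (rule fa_probability_mono[OF P0]) auto
  then have "b * P\<^sub>0 (A \<inter> B) \<le> b * P\<^sub>0 B" using ab by simp
  then have D0: "D > 0" using pos c0 by (simp add: D_def)
  have low: "nat_ext_lower Pl A B \<le> (b * P\<^sub>0 (A \<inter> B) + a) / D"
    using nat_ext_bounds(1)[OF Plow, of B A] D0 by (simp add: vals)
  have up: "(b * P\<^sub>0 (A \<inter> B) + c) / D \<le> nat_ext_upper Pl A B"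
    using nat_ext_bounds(2)[OF Pup, of B A] D0 by (simp add: vals)
  \<comment> \<open>The truncations at 0 and 1 may be active, but they can only narrow the gap
    between \<open>Pl A\<close> and \<open>Pu A\<close>.\<close>
  have PlA: "b * P\<^sub>0 A + a \<le> Pl A" using nU by (simp add: Pl vbm_lower_def)
  have PuA: "Pu A \<le> b * P\<^sub>0 A + c" using nU by (simp add: Pu vbm_upper_def c_def)
  have inner: "Pl A \<le> nat_ext_lower Pl A B'" "nat_ext_upper Pl A B' \<le> Pu A" if "B' \<in> \<B>" for B'
    using con that by (auto simp: constricts_def)
  have no_strict: "\<not> (\<forall>B'\<in>\<B>. nat_ext_lower Pl A B' \<le> Pl A \<and> Pu A \<le> nat_ext_upper Pl A B')"
    using con by (auto simp: constricts_def not_le)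
  show False
  proof (cases "c = a")
    case True
    \<comment> \<open>\<open>a \<le> 0 \<le> c\<close> forces both to vanish.\<close>
    then have eq: "a = 0" "b = 1" using c0 ab by (auto simp: c_def)
    have Pl_P0: "Pl E = P\<^sub>0 E" for E
      using fa_probability_nonneg[OF P0] fa_probability_UNIV[OF P0] by (simp add: Pl vbm_lower_def eq)
    have Pu_P0: "Pu E = P\<^sub>0 E" for E
      using fa_probability_le_1[OF P0, of E] fa_probability_empty[OF P0]
      by (simp add: Pu vbm_upper_def eq)
    \<comment> \<open>The conditional of \<open>P\<^sub>0\<close> given \<open>B'\<close> separates
      the two extensions, while \<open>inner\<close> puts both on the correct sides of
      \<open>P\<^sub>0 A\<close>; all coincide.\<close>
    have "P\<^sub>0 \<in> credal_set Pl" using P0 by (simp add: credal_set_def Pl_P0)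
    then have "nat_ext_lower Pl A B' \<le> nat_ext_upper Pl A B'" "nat_ext_lower Pl A B' \<le> P\<^sub>0 A"
      "P\<^sub>0 A \<le> nat_ext_upper Pl A B'" if "B' \<in> \<B>" for B'
      using nat_ext_bounds[of P\<^sub>0 Pl B' A] inner[OF that] assms(3) that Pl_P0 Pu_P0 by fastforce+
    then show False using no_strict by (simp add: Pl_P0 Pu_P0)
  next
    case False
    then have ca: "c - a > 0" using c0 ab by simp
    have "(b * P\<^sub>0 (A \<inter> B) + c) / D - (b * P\<^sub>0 (A \<inter> B) + a) / D \<le> c - a"
      using low up PlA PuA inner[OF B(1)] by linarith
    then have "(c - a) / D \<le> c - a" by (simp add: diff_divide_distrib[symmetric])
    then have "D \<ge> 1" using D0 ca by (simp add: divide_le_eq)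
    then have "b * P\<^sub>0 B \<ge> b" by (simp add: D_def c_def)
    then have PB: "P\<^sub>0 B = 1" using ab fa_probability_le_1[OF P0, of B] by simp
    then have D1: "D = 1" by (simp add: D_def c_def)
    have null: "P\<^sub>0 E = 0" if "E \<inter> B = {}" for E
      using fa_probability_Un[OF P0 that] fa_probability_le_1[OF P0, of "E \<union> B"]
        fa_probability_nonneg[OF P0, of E] PB by simp
    have only: "B' = B" if "B' \<in> \<B>" for B'
    proof (rule ccontr)
      assume "B' \<noteq> B"
      \<comment> \<open>A second block would be \<open>P\<^sub>0\<close>-null, so
        \<open>Pl B' = max a 0 = 0\<close>, against positivity on \<B>.\<close>
      then have "B' \<inter> B = {}" using assms(2) that B(1) by (auto simp: partition_on_def disjoint_def)
      moreover from this have "B' \<noteq> UNIV" using ne by auto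
      ultimately have "Pl B' = 0" using null[of B'] ab by (simp add: Pl vbm_lower_def)
      then show False using assms(3) that by auto
    qed
    have "- B \<inter> A \<inter> B = {}" by auto
    then have PA: "P\<^sub>0 A = P\<^sub>0 (A \<inter> B)"
      using fa_probability_split[OF P0, of A B] null[of "- B \<inter> A"] by (simp add: Int_commute)
    show False
      \<comment> \<open>With \<open>D = 1\<close> and
        \<open>P\<^sub>0 A = P\<^sub>0 (A \<inter> B)\<close>, the bounds \<open>low\<close> and
        \<open>up\<close> become those of \<open>PlA\<close> and \<open>PuA\<close>.\<close>
      using no_strict only low up PlA PuA unfolding D1 PA by fastforce
  qed
qed

end
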